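(* Let $C\subset\mathbb R^n$ be any convex subset of cardinality not one. Then the map $\Phi:\mathcal T_C\to\mathcal E_C$ from touching cones to exposed faces and the map $\Psi:\mathcal F_C\to\mathcal N_C$ from faces to normal cones define a Galois connection between the touching cone lattice $\mathcal T_C$ and the face lattice $\mathcal F_C$.
   Context: $\mathbb R^n$ carries the standard scalar product. Faces. For a convex set $C\subset\mathbb R^n$, a face of $C$ is a convex subset $F\subset C$ such that $x,y,z\in C$, $y\in F$ and $y\in\,]x,z[\,=\{(1-\lambda)x+\lambda z\mid 0<\lambda<1\}$ imply $x,z\in F$. Put $h_C(u)=\sup\{\langle x,u\rangle\mid x\in C\}$ and, for $u\ne 0$, $H_C(u)=\{x\in\mathbb R^n\mid\langle x,u\rangle=h_C(u)\}$. The exposed faces of $C$ are the non-empty sets of the form $C\cap H_C(u)$, $u\neq 0$, together with $\emptyset$ and $C$. $\mathcal F_C$ and $\mathcal E_C\subset\mathcal F_C$ denote the sets of faces and exposed faces of $C$. Normal and touching cones. The normal cone of $C$ at $x\in C$ is $N(x)=\{u\in\mathbb R^n\mid\langle u,y-x\rangle\le 0\ \forall y\in C\}$; the whole space $\mathbb R^n$ is also a normal cone by definition. A touching cone of $C$ is any non-empty face of any normal cone of $C$. $\mathcal N_C\subset\mathcal T_C$ denote the sets of normal cones and touching cones. All of $\mathcal F_C,\mathcal E_C,\mathcal T_C,\mathcal N_C$ are ordered by inclusion and are complete lattices with intersection as infimum. Maps. For $C\neq\emptyset$ let $\mathrm{lin}(C)=\mathrm{aff}(C)-\mathrm{aff}(C)$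 be the translation space of the affine hull. $\Phi:\mathcal T_C\to\mathcal E_C$ is defined by $\Phi(\mathrm{lin}(C)^\perp)=C$ (for $C\ne\emptyset$), $\Phi(\mathbb R^n)=\emptyset$, and for other $T\in\mathcal T_C$, $\Phi(T)=C\cap H_C(u)$ for any non-zero $u$ in the relative interior of $T$ (this is well-defined). $\Psi:\mathcal F_C\to\mathcal N_C$ is defined by $\Psi(\emptyset)=\mathbb R^n$ and, for $F\neq\emptyset$, $\Psi(F)=N(x)$ for any $x$ in the relative interior of $F$ (this is well-defined). Galois connection. For posets $(L,\le_L)$, $(M,\le_M)$, maps $\theta:L\to M$ and $\phi:M\to L$ define a Galois connection between $L$ and $M$ if for all $l,l_1,l_2\in L$ and $m,m_1,m_2\in M$: $l_1\le_L l_2$ implies $\theta(l_1)\ge_M\theta(l_2)$; $m_1\le_M m_2$ implies $\phi(m_1)\ge_L\phi(m_2)$; $l\le_L\phi(\theta(l))$; and $m\le_M\theta(\phi(m))$. Here $\Phi$ is regarded as a map into $\mathcal F_C\supset\mathcal E_C$ and $\Psi$ as a map into $\mathcal T_C\supset\mathcal N_C$. *)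

theory Defs
  imports "HOL-Analysis.Analysis"
begin

section \<open>Faces and exposed faces\<close>

text \<open>The support function takes values in the extended reals: it is infinite in unbounded
  directions of \<open>C\<close>, and minus infinity everywhere if \<open>C\<close> is empty. In both cases the supporting
  hyperplane below is empty.\<close>

definition support_fun :: "'a::euclidean_space set \<Rightarrow> 'a \<Rightarrow> ereal" where
  "support_fun C u = (SUP x\<in>C. ereal (x \<bullet> u))"

definition supp_hyperplane :: "'a::euclidean_space set \<Rightarrow> 'a \<Rightarrow> 'a set" where
  "supp_hyperplane C u = {x. ereal (x \<bullet> u) = support_fun C u}"

definition faces :: "'a::euclidean_space set \<Rightarrow> 'a set set" where
  "faces C = {F. F face_of C}"

definition exposed_faces :: "'a::euclidean_space set \<Rightarrow> 'a set set" where
  "exposed_faces C =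
     {C \<inter> supp_hyperplane C u | u. u \<noteq> 0 \<and> C \<inter> supp_hyperplane C u \<noteq> {}} \<union> {{}, C}"

section \<open>Normal cones and touching cones\<close>

definition normal_cone :: "'a::euclidean_space set \<Rightarrow> 'a \<Rightarrow> 'a set" where
  "normal_cone C x = {u. \<forall>y\<in>C. u \<bullet> (y - x) \<le> 0}"

text \<open>The whole space counts as a normal cone by convention.\<close>

definition normal_cones :: "'a::euclidean_space set \<Rightarrow> 'a set set" where
  "normal_cones C = insert UNIV (normal_cone C ` C)"

definition touching_cones :: "'a::euclidean_space set \<Rightarrow> 'a set set" where
  "touching_cones C = {T. T \<noteq> {} \<and> (\<exists>N\<in>normal_cones C. T face_of N)}"

section \<open>The maps between touching cones and faces\<close>

definition lin_space :: "'a::euclidean_space set \<Rightarrow> 'a set" where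
  "lin_space C = {x - y | x y. x \<in> affine hull C \<and> y \<in> affine hull C}"

text \<open>The first two clauses of \<open>Phi\<close> conflict only when \<open>C\<close> is a singleton. That the choices made
  by \<open>SOME\<close> do not matter is shown in \<open>Phi_eq\<close> and \<open>Psi_eq\<close> below.\<close>

definition Phi :: "'a::euclidean_space set \<Rightarrow> 'a set \<Rightarrow> 'a set" where
  "Phi C T =
     (if C \<noteq> {} \<and> T = (lin_space C)\<^sup>\<bottom> then C
      else if T = UNIV then {}
      else C \<inter> supp_hyperplane C (SOME u. u \<in> rel_interior T \<and> u \<noteq> 0))"

definition Psi :: "'a::euclidean_space set \<Rightarrow> 'a set \<Rightarrow> 'a set" where
  "Psi C F = (if F = {} then UNIV else normal_cone C (SOME x. x \<in> rel_interior F))"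

section \<open>Galois connections\<close>

text \<open>Antitone Galois connections. The order on \<open>L\<close> and \<open>M\<close> is the one inherited from the ambient
  type; for families of sets this is inclusion.\<close>

definition galois_connection_on ::
    "'a::order set \<Rightarrow> 'b::order set \<Rightarrow> ('a \<Rightarrow> 'b) \<Rightarrow> ('b \<Rightarrow> 'a) \<Rightarrow> bool" where
  "galois_connection_on L M \<theta> \<phi> \<longleftrightarrow>
     \<theta> \<in> L \<rightarrow> M \<and> \<phi> \<in> M \<rightarrow> L \<and>
     (\<forall>l1\<in>L. \<forall>l2\<in>L. l1 \<le> l2 \<longrightarrow> \<theta> l1 \<ge> \<theta> l2) \<and>
     (\<forall>m1\<in>M. \<forall>m2\<in>M. m1 \<le> m2 \<longrightarrow> \<phi> m1 \<ge> \<phi> m2) \<and>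
     (\<forall>l\<in>L. l \<le> \<phi> (\<theta> l)) \<and>
     (\<forall>m\<in>M. m \<le> \<theta> (\<phi> m))"

section \<open>Well-definedness of the two maps\<close>

lemma rel_interior_const_inner:
  fixes S :: "'a::euclidean_space set"
  assumes "convex S" "x \<in> rel_interior S" "\<And>z. z \<in> S \<Longrightarrow> u \<bullet> z \<le> u \<bullet> x" "y \<in> S"
  shows "u \<bullet> y = u \<bullet> x"
proof -
  have "(S \<inter> {z. u \<bullet> z = u \<bullet> x}) face_of S"
    using assms(1,3) by (rule face_of_Int_supporting_hyperplane_le)
  moreover have "(S \<inter> {z. u \<bullet> z = u \<bullet> x}) \<inter> rel_interior S \<noteq> {}"
  proof -
    have "x \<in> S" using assms(2) rel_interior_subset[of S] by (rule set_rev_mp)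
    then show ?thesis using assms(2) by blast
  qed
  ultimately have "S \<subseteq> S \<inter> {z. u \<bullet> z = u \<bullet> x}"
    by (rule subset_of_face_of[OF _ subset_refl])
  then show ?thesis using assms(4) by blast
qed

lemma supp_hyperplane_iff_normal_cone:
  assumes "x \<in> C"
  shows "x \<in> supp_hyperplane C u \<longleftrightarrow> u \<in> normal_cone C x"
proof -
  have "x \<in> supp_hyperplane C u \<longleftrightarrow> support_fun C u \<le> ereal (x \<bullet> u)"
    unfolding supp_hyperplane_def support_fun_def
    using SUP_upper[OF assms, of "\<lambda>x. ereal (x \<bullet> u)"] by (auto simp: eq_iff)
  also have "\<dots> \<longleftrightarrow> (\<forall>y\<in>C. y \<bullet> u \<le> x \<bullet> u)"
    unfolding support_fun_def by (simp add: SUP_le_iff)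
  also have "\<dots> \<longleftrightarrow> u \<in> normal_cone C x"
    unfolding normal_cone_def by (simp add: inner_diff_right inner_commute)
  finally show ?thesis .
qed

lemma normal_cone_rel_interior_subset:
  assumes F: "F face_of C" and x: "x \<in> rel_interior F" and y: "y \<in> F"
  shows "normal_cone C x \<subseteq> normal_cone C y"
proof
  fix u assume u: "u \<in> normal_cone C x"
  have sub: "F \<subseteq> C" using F by (simp add: face_of_imp_subset)
  have "u \<bullet> y = u \<bullet> x"
  proof (rule rel_interior_const_inner[of F])
    show "convex F" using F by (rule face_of_imp_convex)
    fix z assume "z \<in> F"
    then show "u \<bullet> z \<le> u \<bullet> x"
      using u sub by (auto simp: normal_cone_def inner_diff_right)
  qed (use x y in auto)
  then show "u \<in> normal_cone C y"
    using u by (auto simp: normal_cone_def inner_diff_right)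
qed

lemma Psi_eq:
  assumes "F \<in> faces C" "x \<in> rel_interior F"
  shows "Psi C F = normal_cone C x"
proof -
  have F: "F face_of C" using assms by (simp add: faces_def)
  define x' where "x' = (SOME x. x \<in> rel_interior F)"
  have x': "x' \<in> rel_interior F" unfolding x'_def using assms(2) by (rule someI)
  have mem: "x \<in> F" "x' \<in> F" using assms(2) x' rel_interior_subset[of F] by auto
  have "normal_cone C x' = normal_cone C x"
    using normal_cone_rel_interior_subset[OF F x' mem(1)]
      normal_cone_rel_interior_subset[OF F assms(2) mem(2)] by (rule subset_antisym)
  moreover have "F \<noteq> {}" using mem by blast
  ultimately show ?thesis by (simp add: Psi_def x'_def)
qed

lemma Psi_choice_exists:
  assumes "F \<in> faces C" "F \<noteq> {}"
  shows "\<exists>x. x \<in> rel_interior F"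
proof -
  have "convex F" using assms(1) face_of_imp_convex unfolding faces_def by blast
  then have "rel_interior F \<noteq> {}" using assms(2) by (simp add: rel_interior_eq_empty)
  then show ?thesis by blast
qed

lemma face_of_UNIV_cases:
  fixes T :: "'a::euclidean_space set"
  assumes "T face_of UNIV" "T \<noteq> {}"
  shows "T = UNIV"
proof (rule ccontr)
  assume "T \<noteq> UNIV"
  with assms(1) have "T \<inter> rel_interior UNIV = {}" by (rule face_of_disjoint_rel_interior)
  then show False using assms(2) by simp
qed

lemma touching_cone_face_of_normal_cone:
  assumes "T \<in> touching_cones C" "T \<noteq> UNIV"
  obtains a where "a \<in> C" "T face_of normal_cone C a"
proof -
  obtain N where N: "N \<in> normal_cones C" "T face_of N" and "T \<noteq> {}"
    using assms(1) unfolding touching_cones_def by blast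
  then have "N \<noteq> UNIV" using assms(2) face_of_UNIV_cases by metis
  then obtain a where "a \<in> C" "N = normal_cone C a"
    using N(1) unfolding normal_cones_def by blast
  then show thesis using that N(2) by simp
qed

lemma touching_cone_subset_normal_cone:
  assumes T: "T face_of normal_cone C a" and a: "a \<in> C"
    and x: "x \<in> C" and u: "u \<in> rel_interior T" "u \<in> normal_cone C x"
  shows "T \<subseteq> normal_cone C x"
proof
  fix w assume w: "w \<in> T"
  have sub: "T \<subseteq> normal_cone C a" using T by (rule face_of_imp_subset)
  have "u \<in> T" using u(1) rel_interior_subset by blast
  then have "u \<bullet> (x - a) \<le> 0" using sub x by (auto simp: normal_cone_def)
  moreover have "u \<bullet> (a - x) \<le> 0" using u(2) a by (auto simp: normal_cone_def)
  ultimately have u0: "(x - a) \<bullet> u = 0" by (simp add: inner_diff_right inner_commute)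
  have "(x - a) \<bullet> w = (x - a) \<bullet> u"
  proof (rule rel_interior_const_inner[of T])
    show "convex T" using T by (rule face_of_imp_convex)
    fix z assume "z \<in> T"
    then show "(x - a) \<bullet> z \<le> (x - a) \<bullet> u"
      using sub x unfolding u0 by (auto simp: normal_cone_def inner_commute[of "x - a"])
  qed (use u w in auto)
  then have "w \<bullet> x = w \<bullet> a"
    using u0 by (simp add: inner_diff_left inner_commute[of w])
  moreover have "\<forall>y\<in>C. w \<bullet> (y - a) \<le> 0" using w sub by (auto simp: normal_cone_def)
  ultimately show "w \<in> normal_cone C x" by (simp add: normal_cone_def inner_diff_right)
qed

lemma Phi_eq:
  assumes T: "T \<in> touching_cones C" "T \<noteq> (lin_space C)\<^sup>\<bottom>" "T \<noteq> UNIV"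
    and u: "u \<in> rel_interior T" "u \<noteq> 0"
  shows "Phi C T = C \<inter> supp_hyperplane C u"
proof -
  obtain a where a: "a \<in> C" "T face_of normal_cone C a"
    using touching_cone_face_of_normal_cone[OF T(1,3)] by blast
  let ?v = "SOME u. u \<in> rel_interior T \<and> u \<noteq> 0"
  have v: "?v \<in> rel_interior T" using someI_ex[of "\<lambda>u. u \<in> rel_interior T \<and> u \<noteq> 0"] u by blast
  have *: "x \<in> supp_hyperplane C q"
    if "x \<in> C" "x \<in> supp_hyperplane C p" "p \<in> rel_interior T" "q \<in> rel_interior T" for x p q
    using touching_cone_subset_normal_cone[OF a(2,1) that(1,3)] that rel_interior_subset
    by (metis subsetD supp_hyperplane_iff_normal_cone)
  have "C \<inter> supp_hyperplane C ?v = C \<inter> supp_hyperplane C u"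
    using *[OF _ _ v u(1)] *[OF _ _ u(1) v] by blast
  then show ?thesis using T by (simp add: Phi_def)
qed

lemma Phi_choice_exists:
  assumes T: "T \<in> touching_cones C" "T \<noteq> (lin_space C)\<^sup>\<bottom>" "T \<noteq> UNIV"
  shows "\<exists>u. u \<in> rel_interior T \<and> u \<noteq> 0"
proof (rule ccontr)
  assume neg: "\<not> ?thesis"
  obtain a where a: "a \<in> C" "T face_of normal_cone C a"
    using touching_cone_face_of_normal_cone[OF T(1,3)] by blast
  have conv: "convex T" using a(2) by (rule face_of_imp_convex)
  have "T \<noteq> {}" using T(1) by (simp add: touching_cones_def)
  then have "rel_interior T \<noteq> {}" using conv by (simp add: rel_interior_eq_empty)
  then have ri: "rel_interior T = {0}" using neg by blast
  then have "closure T = {0}" using convex_closure_rel_interior[OF conv] by simp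
  then have T0: "T = {0}" using \<open>T \<noteq> {}\<close> closure_subset[of T] by auto
  have "w = 0" if w: "w \<in> (lin_space C)\<^sup>\<bottom>" for w
  proof (rule ccontr)
    assume w0: "w \<noteq> 0"
    have "w \<bullet> (y - a) = 0" if "y \<in> C" for y
    proof -
      have "y - a \<in> lin_space C"
        using that a(1) by (auto simp: lin_space_def intro: hull_inc)
      then show ?thesis
        using w by (auto simp: orthogonal_comp_def orthogonal_def inner_commute)
    qed
    then have "w \<in> normal_cone C a" "- w \<in> normal_cone C a"
      by (auto simp: normal_cone_def)
    moreover have "0 \<in> open_segment w (- w)"
    proof -
      have "w \<noteq> - w"
      proof
        assume "w = - w"
        then have "2 *\<^sub>R w = 0" by (metis add.right_inverse scaleR_2)
        then show False using w0 by simp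
      qed
      then show ?thesis by (auto simp: in_segment intro!: exI[of _ "1/2"])
    qed
    ultimately have "w \<in> T" using face_ofD[OF a(2)] T0 by blast
    then show False using w0 T0 by simp
  qed
  moreover have "0 \<in> (lin_space C)\<^sup>\<bottom>" by (simp add: orthogonal_comp_def orthogonal_def)
  ultimately have "(lin_space C)\<^sup>\<bottom> = {0}" by blast
  then show False using T(2) T0 by simp
qed

end

theory Submission
  imports Defs
begin

text \<open>Both maps are the two polars of a single relation between points \<open>x \<in> C\<close> and vectors \<open>u\<close>,
  namely \<open>u \<in> normal_cone C x\<close>, which says that the functional \<open>(\<bullet>) u\<close> is maximal over
  \<open>C\<close> at \<open>x\<close>. On a
  touching cone \<open>T\<close>, \<open>Phi\<close> collects the points of \<open>C\<close> related to every \<open>u \<in> T\<close>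
  (\<open>Phi_eq_polar\<close>); on a face \<open>F\<close>, \<open>Psi\<close> collects the vectors related to every \<open>x \<in> F\<close>
  (\<open>Psi_eq_polar\<close>). Outside the special clauses, the definitions test the relation at one
  relatively interior element only; this element decides for all the others, since a linear
  functional that is maximal over a convex set at a relatively interior point is constant on
  that set.

  The polars of any relation form an antitone Galois connection, because \<open>F \<subseteq> Phi C T\<close> and
  \<open>T \<subseteq> Psi C F\<close> both say that every element of \<open>F\<close> is related to every element of \<open>T\<close>.
  The clause \<open>Phi C UNIV = {}\<close> fits this description because \<open>C\<close> is not a singleton: at each
  point \<open>x \<in> C\<close>, a vector from \<open>x\<close> to another point of \<open>C\<close> is not normal.\<close>

lemma convex_normal_cone: "convex (normal_cone C x)"
proof -
  have "normal_cone C x = (\<Inter>y\<in>C. {u. (y - x) \<bullet> u \<le> 0})"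
    by (auto simp: normal_cone_def inner_commute)
  then show ?thesis by (simp add: convex_INT convex_halfspace_le)
qed

lemma zero_in_normal_cone: "0 \<in> normal_cone C x"
  by (simp add: normal_cone_def)

lemma normal_cones_subset_touching_cones: "normal_cones C \<subseteq> touching_cones C"
proof
  fix N assume N: "N \<in> normal_cones C"
  then have "convex N" "N \<noteq> {}"
    using convex_normal_cone zero_in_normal_cone unfolding normal_cones_def by blast+
  then show "N \<in> touching_cones C"
    using N face_of_refl by (auto simp: touching_cones_def)
qed

lemma exposed_faces_subset_faces:
  assumes "convex C"
  shows "exposed_faces C \<subseteq> faces C"
proof -
  have "C \<inter> supp_hyperplane C u face_of C" if x: "x \<in> C \<inter> supp_hyperplane C u" for u x
  proof -
    have "C \<inter> supp_hyperplane C u = C \<inter> {z. u \<bullet> z = u \<bullet> x}"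
      using x unfolding supp_hyperplane_def
      by (auto simp: inner_commute[of u] simp flip: ereal.inject)
    moreover have "u \<bullet> z \<le> u \<bullet> x" if "z \<in> C" for z
      using x that supp_hyperplane_iff_normal_cone[of x C u]
      by (auto simp: normal_cone_def inner_diff_right)
    ultimately show ?thesis
      using face_of_Int_supporting_hyperplane_le[OF assms, of u "u \<bullet> x"] by simp
  qed
  then show ?thesis
    using assms by (auto simp: exposed_faces_def faces_def face_of_refl)
qed

text \<open>A direction pointing from \<open>x\<close> to another point of \<open>C\<close> is not normal at \<open>x\<close>.\<close>

lemma normal_cone_eq_UNIV:
  assumes "x \<in> C" "normal_cone C x = UNIV"
  shows "C = {x}"
proof -
  have "y = x" if "y \<in> C" for y
  proof -
    have "y - x \<in> normal_cone C x" using assms(2) by simp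
    then have "(y - x) \<bullet> (y - x) \<le> 0" using that by (auto simp: normal_cone_def)
    then show ?thesis using inner_gt_zero_iff[of "y - x"] by (metis linorder_not_le right_minus_eq)
  qed
  then show ?thesis using assms(1) by blast
qed

lemma lin_space_comp_subset_normal_cone:
  assumes "x \<in> C"
  shows "(lin_space C)\<^sup>\<bottom> \<subseteq> normal_cone C x"
proof
  fix u assume u: "u \<in> (lin_space C)\<^sup>\<bottom>"
  have "u \<bullet> (y - x) = 0" if "y \<in> C" for y
  proof -
    have "y - x \<in> lin_space C"
      using that assms by (auto simp: lin_space_def intro: hull_inc)
    then show ?thesis
      using u by (auto simp: orthogonal_comp_def orthogonal_def inner_commute)
  qed
  then show "u \<in> normal_cone C x" by (simp add: normal_cone_def)
qed

text \<open>The three clauses defining \<open>Phi\<close> are one formula: every point of \<open>C\<close> has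
  \<open>(lin_space C)\<^sup>\<bottom>\<close> in its normal cone, none has \<open>UNIV\<close>, and for any other \<open>T\<close> a normal cone
  that contains a relatively interior vector of \<open>T\<close> contains all of \<open>T\<close>.\<close>

lemma Phi_eq_polar:
  assumes C: "\<not> is_singleton C" and T: "T \<in> touching_cones C"
  shows "Phi C T = {x \<in> C. T \<subseteq> normal_cone C x}"
proof -
  consider (lin) "C \<noteq> {}" "T = (lin_space C)\<^sup>\<bottom>"
    | (univ) "C = {} \<or> T \<noteq> (lin_space C)\<^sup>\<bottom>" "T = UNIV"
    | (other) "T \<noteq> (lin_space C)\<^sup>\<bottom>" "T \<noteq> UNIV"
    | (empty) "C = {}" "T \<noteq> UNIV"
    by blast
  then show ?thesis
  proof cases
    case lin
    then show ?thesis using lin_space_comp_subset_normal_cone by (auto simp: Phi_def)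
  next
    case univ
    have "normal_cone C x \<noteq> UNIV" if "x \<in> C" for x
      using normal_cone_eq_UNIV[OF that] C by (auto simp: is_singleton_def)
    then show ?thesis using univ by (auto simp: Phi_def)
  next
    case other
    obtain u where u: "u \<in> rel_interior T" "u \<noteq> 0"
      using Phi_choice_exists[OF T other] by blast
    obtain a where a: "a \<in> C" "T face_of normal_cone C a"
      using touching_cone_face_of_normal_cone[OF T other(2)] by blast
    have "u \<in> T" using u(1) rel_interior_subset by blast
    then have "x \<in> supp_hyperplane C u \<longleftrightarrow> T \<subseteq> normal_cone C x" if "x \<in> C" for x
      using touching_cone_subset_normal_cone[OF a(2,1) that u(1)]
        supp_hyperplane_iff_normal_cone[OF that] by blast
    then show ?thesis using Phi_eq[OF T other u] by blast
  next
    case empty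
    then show ?thesis by (auto simp: Phi_def)
  qed
qed

text \<open>A vector normal at one relatively interior point of the face \<open>F\<close> is normal at all points
  of \<open>F\<close>, so the intersection below is the normal cone at that point.\<close>

lemma Psi_eq_polar:
  assumes F: "F \<in> faces C"
  shows "Psi C F = (\<Inter>x\<in>F. normal_cone C x)"
proof (cases "F = {}")
  case True
  then show ?thesis by (simp add: Psi_def)
next
  case False
  obtain x where x: "x \<in> rel_interior F" using Psi_choice_exists[OF F False] by blast
  have "x \<in> F" using x rel_interior_subset by blast
  then show ?thesis
    using normal_cone_rel_interior_subset[OF _ x] F
    unfolding Psi_eq[OF F x] faces_def by blast
qed

lemma Phi_in_exposed_faces:
  assumes T: "T \<in> touching_cones C"
  shows "Phi C T \<in> exposed_faces C"
proof (cases "T = (lin_space C)\<^sup>\<bottom> \<or> T = UNIV")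
  case True
  then show ?thesis by (auto simp: Phi_def exposed_faces_def)
next
  case False
  then obtain u where u: "u \<in> rel_interior T" "u \<noteq> 0"
    using Phi_choice_exists[OF T] by blast
  have "Phi C T = C \<inter> supp_hyperplane C u" using Phi_eq[OF T _ _ u] False by blast
  then show ?thesis using u(2) by (auto simp: exposed_faces_def)
qed

lemma Psi_in_normal_cones:
  assumes F: "F \<in> faces C"
  shows "Psi C F \<in> normal_cones C"
proof (cases "F = {}")
  case True
  then show ?thesis by (simp add: Psi_def normal_cones_def)
next
  case False
  obtain x where x: "x \<in> rel_interior F" using Psi_choice_exists[OF F False] by blast
  moreover have "x \<in> C"
    using x rel_interior_subset F face_of_imp_subset unfolding faces_def by blast
  ultimately show ?thesis using Psi_eq[OF F x] by (simp add: normal_cones_def)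
qed

text \<open>An antitone Galois connection is the same as one equivalence that moves elements across the
  two orders; monotonicity follows by transitivity from the two unit inequalities.\<close>

lemma galois_connection_onI:
  assumes maps: "\<theta> \<in> L \<rightarrow> M" "\<phi> \<in> M \<rightarrow> L"
    and adj: "\<And>l m. l \<in> L \<Longrightarrow> m \<in> M \<Longrightarrow> m \<le> \<theta> l \<longleftrightarrow> l \<le> \<phi> m"
  shows "galois_connection_on L M \<theta> \<phi>"
proof -
  have unit_L: "l \<le> \<phi> (\<theta> l)" if "l \<in> L" for l
    using adj[of l "\<theta> l"] maps that by auto
  have unit_M: "m \<le> \<theta> (\<phi> m)" if "m \<in> M" for m
    using adj[of "\<phi> m" m] maps that by auto
  have "\<theta> l2 \<le> \<theta> l1" if "l1 \<in> L" "l2 \<in> L" "l1 \<le> l2" for l1 l2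
  proof -
    have "l1 \<le> \<phi> (\<theta> l2)" using that(3) unit_L[OF that(2)] by (rule order_trans)
    then show ?thesis using adj maps that by blast
  qed
  moreover have "\<phi> m2 \<le> \<phi> m1" if "m1 \<in> M" "m2 \<in> M" "m1 \<le> m2" for m1 m2
  proof -
    have "m1 \<le> \<theta> (\<phi> m2)" using that(3) unit_M[OF that(2)] by (rule order_trans)
    then show ?thesis using adj maps that by blast
  qed
  ultimately show ?thesis
    using maps unit_L unit_M by (simp add: galois_connection_on_def)
qed

theorem theorem3p8:
  fixes C :: "(real ^ 'n) set"
  assumes "convex C"
    and "\<not> is_singleton C"
  shows "Phi C \<in> touching_cones C \<rightarrow> exposed_faces C \<and>
         Psi C \<in> faces C \<rightarrow> normal_cones C \<and>
         galois_connection_on (touching_cones C) (faces C) (Phi C) (Psi C)"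
proof (intro conjI)
  show Phi: "Phi C \<in> touching_cones C \<rightarrow> exposed_faces C"
    using Phi_in_exposed_faces by blast
  show Psi: "Psi C \<in> faces C \<rightarrow> normal_cones C"
    using Psi_in_normal_cones by blast
  show "galois_connection_on (touching_cones C) (faces C) (Phi C) (Psi C)"
  proof (rule galois_connection_onI)
    show "Phi C \<in> touching_cones C \<rightarrow> faces C"
      using Phi exposed_faces_subset_faces[OF assms(1)] by blast
    show "Psi C \<in> faces C \<rightarrow> touching_cones C"
      using Psi normal_cones_subset_touching_cones by blast
    fix T F assume T: "T \<in> touching_cones C" and F: "F \<in> faces C"
    have "F \<subseteq> C" using F by (simp add: faces_def face_of_imp_subset)
    then show "F \<subseteq> Phi C T \<longleftrightarrow> T \<subseteq> Psi C F"
      unfolding Phi_eq_polar[OF assms(2) T] Psi_eq_polar[OF F] by blast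
  qed
qed

end
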